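(* Let $C([0,1])$ be the C*-algebra of continuous complex-valued functions on $[0,1]$ with the supremum norm, and let $\rho$ be the faithful trace on $C([0,1])$ given by $\rho(f)=\int_0^1 f(x)\,dx$ (Lebesgue integral). Then, on the density space $D_\rho(C([0,1]))$, the topology induced by the C*-norm metric $d_{C([0,1])}$ is strictly finer than the topology induced by the Bures metric $d_B^\rho$.
   Context: For a unital C*-algebra $\mathcal{A}$ with positive elements $\mathcal{A}_+$ and a faithful trace $\tau$ on $\mathcal{A}$, the density space is $D_\tau(\mathcal{A})=\{a\in\mathcal{A}_+ : \tau(a)=1\}$. The C*-norm metric is $d_{\mathcal{A}}(x,y)=\|x-y\|_{\mathcal{A}}$ (here restricted to the density space). The Bures metric on $D_\tau(\mathcal{A})$ is $d_B^\tau(x,y)=\sqrt{1-\tau(|\sqrt{x}\sqrt{y}|)}$, where $\sqrt{\cdot}$ is the positive square root and $|a|=\sqrt{a^*a}$; it is known (Farenick–Rahaman) that $d_B^\tau$ is a metric. *)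

theory Defs
  imports "HOL-Analysis.Analysis"
begin

section \<open>Unital C*-algebras\<close>

class scaleC =
  fixes scaleC :: "complex \<Rightarrow> 'a \<Rightarrow> 'a" (infixr "*\<^sub>C" 75)

class star =
  fixes star :: "'a \<Rightarrow> 'a"

class unital_cstar_algebra = real_normed_algebra_1 + banach + scaleC + star +
  assumes scaleR_scaleC: "r *\<^sub>R a = complex_of_real r *\<^sub>C a"
    and scaleC_add_right: "c *\<^sub>C (a + b) = c *\<^sub>C a + c *\<^sub>C b"
    and scaleC_add_left: "(c + d) *\<^sub>C a = c *\<^sub>C a + d *\<^sub>C a"
    and scaleC_scaleC: "c *\<^sub>C (d *\<^sub>C a) = (c * d) *\<^sub>C a"
    and scaleC_one: "1 *\<^sub>C a = a"
    and scaleC_mult_left: "(c *\<^sub>C a) * b = c *\<^sub>C (a * b)"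
    and scaleC_mult_right: "a * (c *\<^sub>C b) = c *\<^sub>C (a * b)"
    and norm_scaleC: "norm (c *\<^sub>C a) = cmod c * norm a"
    and star_add: "star (a + b) = star a + star b"
    and star_scaleC: "star (c *\<^sub>C a) = cnj c *\<^sub>C star a"
    and star_mult: "star (a * b) = star b * star a"
    and star_star: "star (star a) = a"
    and cstar_identity: "norm (star a * a) = (norm a)\<^sup>2"

definition spectrum :: "'a::unital_cstar_algebra \<Rightarrow> complex set" where
  "spectrum a = {z. \<not> (\<exists>b. b * (z *\<^sub>C 1 - a) = 1 \<and> (z *\<^sub>C 1 - a) * b = 1)}"

definition positive_elements :: "'a::unital_cstar_algebra set" where
  "positive_elements = {a. star a = a \<and> spectrum a \<subseteq> \<real>\<^sub>\<ge>\<^sub>0}"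

definition positive_sqrt :: "'a::unital_cstar_algebra \<Rightarrow> 'a" where
  "positive_sqrt a = (THE b. b \<in> positive_elements \<and> b * b = a)"

definition cstar_abs :: "'a::unital_cstar_algebra \<Rightarrow> 'a" where
  "cstar_abs a = positive_sqrt (star a * a)"

definition faithful_trace :: "('a::unital_cstar_algebra \<Rightarrow> complex) \<Rightarrow> bool" where
  "faithful_trace \<tau> \<longleftrightarrow>
     (\<forall>a b. \<tau> (a + b) = \<tau> a + \<tau> b) \<and>
     (\<forall>c a. \<tau> (c *\<^sub>C a) = c * \<tau> a) \<and>
     (\<forall>a\<in>positive_elements. \<tau> a \<in> \<real>\<^sub>\<ge>\<^sub>0) \<and>
     (\<forall>a b. \<tau> (a * b) = \<tau> (b * a)) \<and>
     (\<forall>a\<in>positive_elements. \<tau> a = 0 \<longrightarrow> a = 0)"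

definition density_space :: "('a::unital_cstar_algebra \<Rightarrow> complex) \<Rightarrow> 'a set" where
  "density_space \<tau> = {a \<in> positive_elements. \<tau> a = 1}"

definition cstar_norm_dist :: "'a::unital_cstar_algebra \<Rightarrow> 'a \<Rightarrow> real" where
  "cstar_norm_dist x y = norm (x - y)"

text \<open>
  A trace takes real values on positive elements, so taking the real part below only changes
  the type.  The value 0 outside of the density space is a convention: the locale
  \<^locale>\<open>Metric_space\<close> asks for nonnegativity and symmetry on the whole type.
\<close>

definition bures_dist :: "('a::unital_cstar_algebra \<Rightarrow> complex) \<Rightarrow> 'a \<Rightarrow> 'a \<Rightarrow> real" where
  "bures_dist \<tau> x y =
     (if x \<in> density_space \<tau> \<and> y \<in> density_space \<tau>
      then sqrt (1 - Re (\<tau> (cstar_abs (positive_sqrt x * positive_sqrt y))))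
      else 0)"

section \<open>The C*-algebra of bounded continuous functions\<close>

instantiation complex :: unital_cstar_algebra
begin

definition scaleC_complex :: "complex \<Rightarrow> complex \<Rightarrow> complex" where
  "scaleC_complex c a = c * a"

definition star_complex :: "complex \<Rightarrow> complex" where
  "star_complex a = cnj a"

instance
  by standard
    (auto simp: scaleC_complex_def star_complex_def algebra_simps scaleR_conv_of_real
      norm_mult power2_eq_square)

end

instance bcontfun :: (metric_space, banach) banach ..

instantiation bcontfun :: (topological_space, real_normed_algebra_1) real_normed_algebra_1
begin

definition one_bcontfun :: "'a \<Rightarrow>\<^sub>C 'b" where
  "one_bcontfun = const_bcontfun 1"

definition times_bcontfun :: "('a \<Rightarrow>\<^sub>C 'b) \<Rightarrow> ('a \<Rightarrow>\<^sub>C 'b) \<Rightarrow> 'a \<Rightarrow>\<^sub>C 'b" where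
  "times_bcontfun f g = Bcontfun (\<lambda>x. f x * g x)"

lemma apply_bcontfun_one [simp]: "apply_bcontfun (1 :: 'a \<Rightarrow>\<^sub>C 'b) x = 1"
  by (simp add: one_bcontfun_def)

lemma apply_bcontfun_times [simp]:
  "apply_bcontfun (f * g) x = f x * g x" for f g :: "'a \<Rightarrow>\<^sub>C 'b"
proof -
  have "(\<lambda>x. f x * g x) \<in> bcontfun"
  proof (rule bcontfun_normI)
    show "norm (f x * g x) \<le> norm f * norm g" for x
      by (rule order_trans[OF norm_mult_ineq]) (simp add: mult_mono norm_bounded)
  qed (intro continuous_intros continuous_on_apply_bcontfun)
  then show ?thesis
    by (simp add: times_bcontfun_def Bcontfun_inverse)
qed

instance
proof
  fix f g h :: "'a \<Rightarrow>\<^sub>C 'b" and r :: real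
  show "f * g * h = f * (g * h)" "(f + g) * h = f * h + g * h" "f * (g + h) = f * g + f * h"
    "1 * f = f" "f * 1 = f" "(r *\<^sub>R f) * g = r *\<^sub>R (f * g)" "f * (r *\<^sub>R g) = r *\<^sub>R (f * g)"
    by (auto intro!: bcontfun_eqI simp: algebra_simps)
  have "apply_bcontfun (0 :: 'a \<Rightarrow>\<^sub>C 'b) x \<noteq> apply_bcontfun (1 :: 'a \<Rightarrow>\<^sub>C 'b) x" for x
    by simp
  then show "(0 :: 'a \<Rightarrow>\<^sub>C 'b) \<noteq> 1"
    by metis
  show "norm (f * g) \<le> norm f * norm g"
  proof (rule norm_bound)
    show "norm (apply_bcontfun (f * g) x) \<le> norm f * norm g" for x
      by (simp, rule order_trans[OF norm_mult_ineq]) (simp add: mult_mono norm_bounded)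
  qed
  have "norm (1 :: 'a \<Rightarrow>\<^sub>C 'b) \<le> 1"
    by (rule norm_bound) simp
  moreover have "1 \<le> norm (1 :: 'a \<Rightarrow>\<^sub>C 'b)"
    using norm_bounded[of "1 :: 'a \<Rightarrow>\<^sub>C 'b"] by simp
  ultimately show "norm (1 :: 'a \<Rightarrow>\<^sub>C 'b) = 1"
    by simp
qed

end

lemma norm_star [simp]: "norm (star a) = norm a" for a :: "'a::unital_cstar_algebra"
proof -
  have le: "norm b \<le> norm (star b)" for b :: 'a
  proof (cases "b = 0")
    case False
    have "norm b * norm b \<le> norm (star b) * norm b"
      using norm_mult_ineq[of "star b" b] cstar_identity[of b] by (simp add: power2_eq_square)
    then show ?thesis
      using False by simp
  qed simp
  show ?thesis
    using le[of a] le[of "star a"] by (simp add: star_star)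
qed

lemma star_minus: "star (a - b) = star a - star b" for a b :: "'a::unital_cstar_algebra"
  using star_add[of "a - b" b] by simp

lemma continuous_on_star: "continuous_on S (star :: 'a::unital_cstar_algebra \<Rightarrow> 'a)"
  by (auto simp: continuous_on_iff dist_norm simp flip: star_minus)

instantiation bcontfun :: (metric_space, unital_cstar_algebra) unital_cstar_algebra
begin

definition scaleC_bcontfun :: "complex \<Rightarrow> ('a \<Rightarrow>\<^sub>C 'b) \<Rightarrow> 'a \<Rightarrow>\<^sub>C 'b" where
  "scaleC_bcontfun c f = Bcontfun (\<lambda>x. c *\<^sub>C f x)"

definition star_bcontfun :: "('a \<Rightarrow>\<^sub>C 'b) \<Rightarrow> 'a \<Rightarrow>\<^sub>C 'b" where
  "star_bcontfun f = Bcontfun (\<lambda>x. star (f x))"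

lemma apply_bcontfun_scaleC [simp]:
  "apply_bcontfun (c *\<^sub>C f) x = c *\<^sub>C f x" for f :: "'a \<Rightarrow>\<^sub>C 'b"
proof -
  have eq: "c *\<^sub>C f x = (c *\<^sub>C 1) * f x" for x
    by (simp add: scaleC_mult_left)
  have "(\<lambda>x. c *\<^sub>C f x) \<in> bcontfun"
  proof (rule bcontfun_normI)
    show "continuous_on UNIV (\<lambda>x. c *\<^sub>C f x)"
      unfolding eq by (intro continuous_intros continuous_on_apply_bcontfun)
    show "norm (c *\<^sub>C f x) \<le> cmod c * norm f" for x
      by (simp add: norm_scaleC mult_left_mono norm_bounded)
  qed
  then show ?thesis
    by (simp add: scaleC_bcontfun_def Bcontfun_inverse)
qed

lemma apply_bcontfun_star [simp]:
  "apply_bcontfun (star f) x = star (f x)" for f :: "'a \<Rightarrow>\<^sub>C 'b"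
proof -
  have "(\<lambda>x. star (f x)) \<in> bcontfun"
    by (rule bcontfun_normI[where b = "norm f"])
      (auto simp: norm_bounded
        intro: continuous_on_compose2[OF continuous_on_star continuous_on_apply_bcontfun])
  then show ?thesis
    by (simp add: star_bcontfun_def Bcontfun_inverse)
qed

instance
proof
  fix f g :: "'a \<Rightarrow>\<^sub>C 'b" and c d :: complex and r :: real
  show "r *\<^sub>R f = complex_of_real r *\<^sub>C f" "c *\<^sub>C (f + g) = c *\<^sub>C f + c *\<^sub>C g"
    "(c + d) *\<^sub>C f = c *\<^sub>C f + d *\<^sub>C f" "c *\<^sub>C (d *\<^sub>C f) = (c * d) *\<^sub>C f" "1 *\<^sub>C f = f"
    "(c *\<^sub>C f) * g = c *\<^sub>C (f * g)" "f * (c *\<^sub>C g) = c *\<^sub>C (f * g)"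
    "star (f + g) = star f + star g" "star (c *\<^sub>C f) = cnj c *\<^sub>C star f"
    "star (f * g) = star g * star f" "star (star f) = f"
    by (auto intro!: bcontfun_eqI
        simp: scaleR_scaleC scaleC_add_right scaleC_add_left scaleC_scaleC scaleC_one
          scaleC_mult_left scaleC_mult_right star_add star_scaleC star_mult star_star)
  have le: "norm (c *\<^sub>C f) \<le> cmod c * norm f" for c and f :: "'a \<Rightarrow>\<^sub>C 'b"
    by (rule norm_bound) (simp add: norm_scaleC mult_left_mono norm_bounded)
  show "norm (c *\<^sub>C f) = cmod c * norm f"
  proof (rule antisym[OF le])
    have ge: "norm f' \<le> B" if "\<And>x. norm (apply_bcontfun f' x) \<le> B" for f' :: "'a \<Rightarrow>\<^sub>C 'b" and B
      using that by (rule norm_bound)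
    show "cmod c * norm f \<le> norm (c *\<^sub>C f)"
    proof (cases "c = 0")
      case False
      have "norm f \<le> norm (c *\<^sub>C f) / cmod c"
      proof (rule ge)
        fix x
        have "cmod c * norm (f x) \<le> norm (c *\<^sub>C f)"
          using norm_bounded[of "c *\<^sub>C f" x] by (simp add: norm_scaleC)
        then show "norm (f x) \<le> norm (c *\<^sub>C f) / cmod c"
          using False by (simp add: field_simps)
      qed
      then show ?thesis
        using False by (simp add: field_simps)
    qed simp
  qed
  show "norm (star f * f) = (norm f)\<^sup>2"
  proof (rule antisym)
    show "norm (star f * f) \<le> (norm f)\<^sup>2"
      by (rule norm_bound) (simp add: cstar_identity power_mono norm_bounded)
    have "norm f \<le> sqrt (norm (star f * f))"
    proof (rule norm_bound)
      show "norm (f x) \<le> sqrt (norm (star f * f))" for x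
        using norm_bounded[of "star f * f" x] by (intro real_le_rsqrt) (simp add: cstar_identity)
    qed
    then show "(norm f)\<^sup>2 \<le> norm (star f * f)"
      using power_mono[OF _ norm_ge_zero, of f _ 2] by fastforce
  qed
qed

end

section \<open>The algebra \<open>C([0,1])\<close> and its trace\<close>

typedef unit_interval = "{0..1::real}"
  by auto

instantiation unit_interval :: metric_space
begin

definition dist_unit_interval :: "unit_interval \<Rightarrow> unit_interval \<Rightarrow> real" where
  "dist_unit_interval s t = dist (Rep_unit_interval s) (Rep_unit_interval t)"

definition uniformity_unit_interval :: "(unit_interval \<times> unit_interval) filter" where
  "uniformity_unit_interval = (INF e\<in>{0<..}. principal {(s, t). dist s t < e})"

definition open_unit_interval :: "unit_interval set \<Rightarrow> bool" where
  "open_unit_interval U \<longleftrightarrow> (\<forall>s\<in>U. \<forall>\<^sub>F (s', t) in uniformity. s' = s \<longrightarrow> t \<in> U)"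

instance
  by standard
    (auto simp: dist_unit_interval_def uniformity_unit_interval_def open_unit_interval_def
      Rep_unit_interval_inject dist_triangle2)

end

lemma continuous_on_Abs_unit_interval: "continuous_on {0..1} Abs_unit_interval"
  by (auto simp: continuous_on_iff dist_unit_interval_def Abs_unit_interval_inverse)

lemma compact_unit_interval: "compact (UNIV :: unit_interval set)"
proof -
  have "UNIV = Abs_unit_interval ` {0..1}"
    by (metis Rep_unit_interval Rep_unit_interval_inverse UNIV_eq_I image_eqI)
  then show ?thesis
    by (metis compact_Icc compact_continuous_image continuous_on_Abs_unit_interval)
qed

text \<open>
  By compactness the type below contains all continuous functions on \<open>[0,1]\<close>; its norm is the
  supremum norm.
\<close>

type_synonym C01 = "unit_interval \<Rightarrow>\<^sub>C complex"

lemma bcontfun_unit_interval: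
  "f \<in> bcontfun \<longleftrightarrow> continuous_on UNIV f" for f :: "unit_interval \<Rightarrow> complex"
  using compact_unit_interval
  by (auto simp: bcontfun_def intro!: compact_imp_bounded compact_continuous_image)

lemma norm_C01: "norm f = (SUP t. cmod (f t))" for f :: C01
  by (simp add: norm_bcontfun_def dist_bcontfun.rep_eq)

definition rho :: "C01 \<Rightarrow> complex" where
  "rho f = (LINT t:{0..1}|lborel. f (Abs_unit_interval t))"

section \<open>The trace and the metrics are well defined\<close>

lemma scaleC_one_C01 [simp]: "apply_bcontfun (z *\<^sub>C (1 :: C01)) t = z"
  by (simp add: scaleC_complex_def)

lemma positive_elements_C01:
  "f \<in> positive_elements \<longleftrightarrow> (\<forall>t. f t \<in> \<real>\<^sub>\<ge>\<^sub>0)" for f :: C01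
proof
  assume f: "f \<in> positive_elements"
  show "\<forall>t. f t \<in> \<real>\<^sub>\<ge>\<^sub>0"
  proof
    fix t
    have "f t \<in> spectrum f"
    proof -
      have "b * (f t *\<^sub>C 1 - f) \<noteq> 1" for b :: C01
      proof
        assume "b * (f t *\<^sub>C 1 - f) = 1"
        then have "apply_bcontfun (b * (f t *\<^sub>C 1 - f)) t = 1"
          by simp
        then show False
          by (simp del: apply_bcontfun_scaleC)
      qed
      then show ?thesis
        by (auto simp: spectrum_def)
    qed
    then show "f t \<in> \<real>\<^sub>\<ge>\<^sub>0"
      using f by (auto simp: positive_elements_def)
  qed
next
  assume f: "\<forall>t. f t \<in> \<real>\<^sub>\<ge>\<^sub>0"
  have "star f = f"
    using f by (intro bcontfun_eqI) (simp add: star_complex_def complex_nonneg_Reals_iff complex_eq_iff)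
  moreover have "z \<in> \<real>\<^sub>\<ge>\<^sub>0" if z: "z \<in> spectrum f" for z
  proof (rule ccontr)
    assume "z \<notin> \<real>\<^sub>\<ge>\<^sub>0"
    then have nz: "z - f t \<noteq> 0" for t
      using f by (metis eq_iff_diff_eq_0)
    define b where "b = Bcontfun (\<lambda>t. inverse (z - f t))"
    have "(\<lambda>t. inverse (z - f t)) \<in> bcontfun"
      using nz by (auto simp: bcontfun_unit_interval intro!: continuous_intros)
    then have b: "b t = inverse (z - f t)" for t
      by (simp add: b_def Bcontfun_inverse)
    have "b * (z *\<^sub>C 1 - f) = 1" "(z *\<^sub>C 1 - f) * b = 1"
      using nz by (auto intro!: bcontfun_eqI simp: b simp del: apply_bcontfun_scaleC)
    then show False
      using z by (auto simp: spectrum_def)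
  qed
  ultimately show "f \<in> positive_elements"
    by (auto simp: positive_elements_def)
qed

lemma positive_sqrt_C01:
  fixes f :: C01
  assumes f: "f \<in> positive_elements"
  shows "apply_bcontfun (positive_sqrt f) t = of_real (sqrt (Re (f t)))"
proof -
  have f': "f t = of_real (Re (f t))" "0 \<le> Re (f t)" for t
    using f by (auto simp: positive_elements_C01 complex_nonneg_Reals_iff complex_eq_iff)
  define b where "b = Bcontfun (\<lambda>t. complex_of_real (sqrt (Re (f t))))"
  have "(\<lambda>t. complex_of_real (sqrt (Re (f t)))) \<in> bcontfun"
    by (auto simp: bcontfun_unit_interval intro!: continuous_intros)
  then have b: "b t = of_real (sqrt (Re (f t)))" for t
    by (simp add: b_def Bcontfun_inverse)
  have "positive_sqrt f = b"
    unfolding positive_sqrt_def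
  proof (rule the_equality)
    have "b * b = f"
      using f' by (intro bcontfun_eqI) (simp add: b flip: of_real_mult)
    then show "b \<in> positive_elements \<and> b * b = f"
      using f' by (auto simp: positive_elements_C01 b)
  next
    fix c
    assume c: "c \<in> positive_elements \<and> c * c = f"
    show "c = b"
    proof (rule bcontfun_eqI)
      fix t
      have c': "c t = of_real (Re (c t))" "0 \<le> Re (c t)"
        using c by (auto simp: positive_elements_C01 complex_nonneg_Reals_iff complex_eq_iff)
      have "f t = of_real (Re (c t) * Re (c t))"
        using c c' by (metis apply_bcontfun_times of_real_mult)
      then have "Re (f t) = Re (c t) * Re (c t)"
        by simp
      then have "sqrt (Re (f t)) = Re (c t)"
        using c' by simp
      then show "c t = b t"
        using c' b by simp
    qed
  qed
  then show ?thesis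
    by (simp add: b)
qed

lemma cstar_abs_C01: "apply_bcontfun (cstar_abs f) t = of_real (cmod (f t))" for f :: C01
proof -
  have *: "apply_bcontfun (star f * f) t = of_real ((cmod (f t))\<^sup>2)" for t
    by (simp only: apply_bcontfun_times apply_bcontfun_star star_complex_def complex_norm_square mult.commute)
  then have "star f * f \<in> positive_elements"
    by (simp add: positive_elements_C01 del: apply_bcontfun_times)
  then show ?thesis
    unfolding cstar_abs_def by (simp add: positive_sqrt_C01 * del: apply_bcontfun_times)
qed

lemma continuous_on_C01: "continuous_on {0..1} (\<lambda>t. apply_bcontfun f (Abs_unit_interval t))"
  by (intro continuous_on_compose2[OF continuous_on_apply_bcontfun continuous_on_Abs_unit_interval]) auto

lemma rho_integral: "rho f = integral {0..1} (\<lambda>t. f (Abs_unit_interval t))"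
  unfolding rho_def
  by (intro set_borel_integral_eq_integral borel_integrable_atLeastAtMost' continuous_on_C01)

lemma rho_of_real:
  fixes f :: C01 and g :: "real \<Rightarrow> real"
  assumes "\<And>t. t \<in> {0..1} \<Longrightarrow> f (Abs_unit_interval t) = complex_of_real (g t)"
    and "continuous_on {0..1} g"
  shows "rho f = of_real (integral {0..1} g)"
proof -
  have "((\<lambda>t. complex_of_real (g t)) has_integral of_real (integral {0..1} g)) {0..1}"
    using has_integral_linear[OF integrable_integral bounded_linear_of_real]
      integrable_continuous_interval[OF assms(2)] by (fastforce simp: o_def)
  then have "((\<lambda>t. f (Abs_unit_interval t)) has_integral of_real (integral {0..1} g)) {0..1}"
    using assms(1) by (metis (no_types, lifting) has_integral_cong)
  then show ?thesis
    by (simp add: rho_integral integral_unique)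
qed

lemma rho_Re:
  assumes "f \<in> positive_elements"
  shows "rho f = of_real (integral {0..1} (\<lambda>t. Re (f (Abs_unit_interval t))))"
  using assms
  by (intro rho_of_real continuous_intros continuous_on_C01)
    (auto simp: positive_elements_C01 complex_nonneg_Reals_iff complex_eq_iff)

lemma C01_eqI:
  fixes f g :: C01
  assumes "\<And>t. t \<in> {0..1} \<Longrightarrow> f (Abs_unit_interval t) = g (Abs_unit_interval t)"
  shows "f = g"
  using assms by (intro bcontfun_eqI) (metis Abs_unit_interval_cases)

lemma faithful_trace_rho: "faithful_trace rho"
proof -
  have int: "(\<lambda>t. f (Abs_unit_interval t)) integrable_on {0..1}" for f :: C01
    by (intro integrable_continuous_interval continuous_on_C01)
  show ?thesis
    unfolding faithful_trace_def
  proof (intro conjI allI ballI impI)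
    fix a b :: C01 and c
    show "rho (a + b) = rho a + rho b"
      using int by (simp add: rho_integral integral_add)
    show "rho (c *\<^sub>C a) = c * rho a"
      by (simp add: rho_integral scaleC_complex_def)
    show "rho (a * b) = rho (b * a)"
      by (simp add: rho_integral mult.commute)
  next
    fix a :: C01
    assume a: "a \<in> positive_elements"
    then have nn: "0 \<le> Re (a t)" "Im (a t) = 0" for t
      by (auto simp: positive_elements_C01 complex_nonneg_Reals_iff)
    have cont: "continuous_on {0..1} (\<lambda>t. Re (a (Abs_unit_interval t)))"
      by (intro continuous_intros continuous_on_C01)
    show "rho a \<in> \<real>\<^sub>\<ge>\<^sub>0"
      using nn by (simp add: rho_Re[OF a] integral_nonneg integrable_continuous_interval[OF cont])
    assume "rho a = 0"
    then have "integral {0..1} (\<lambda>t. Re (a (Abs_unit_interval t))) = 0"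
      by (simp add: rho_Re[OF a])
    then have "\<forall>t\<in>{0..1}. Re (a (Abs_unit_interval t)) = 0"
      using integral_eq_0_iff[OF cont] nn by simp
    then show "a = 0"
      using nn by (intro C01_eqI) (simp add: complex_eq_iff)
  qed
qed

lemma Metric_space_cstar_norm_dist: "Metric_space M cstar_norm_dist"
  by (rule Metric_space.intro)
    (auto simp: cstar_norm_dist_def norm_minus_commute intro: norm_triangle_sub
      simp flip: dist_norm intro: dist_triangle)

lemma integral_Cauchy_Schwarz:
  fixes u v :: "real \<Rightarrow> real"
  assumes u: "continuous_on {0..1} u" and v: "continuous_on {0..1} v"
  shows "(integral {0..1} (\<lambda>t. u t * v t))\<^sup>2
    \<le> integral {0..1} (\<lambda>t. (u t)\<^sup>2) * integral {0..1} (\<lambda>t. (v t)\<^sup>2)"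
proof -
  define A B C where "A = integral {0..1} (\<lambda>t. (u t)\<^sup>2)"
    and "B = integral {0..1} (\<lambda>t. u t * v t)" and "C = integral {0..1} (\<lambda>t. (v t)\<^sup>2)"
  have int: "(\<lambda>t. (u t)\<^sup>2) integrable_on {0..1}" "(\<lambda>t. u t * v t) integrable_on {0..1}"
    "(\<lambda>t. (v t)\<^sup>2) integrable_on {0..1}"
    by (intro integrable_continuous_interval continuous_intros u v)+
  have quad: "0 \<le> A + 2 * s * B + s\<^sup>2 * C" for s
  proof -
    have "((\<lambda>t. (u t)\<^sup>2 + (2 * s) * (u t * v t) + s\<^sup>2 * (v t)\<^sup>2) has_integral
        (A + (2 * s) * B + s\<^sup>2 * C)) {0..1}"
      unfolding A_def B_def C_def
      by (intro has_integral_add has_integral_mult_right integrable_integral int)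
    then show ?thesis
    proof (rule has_integral_nonneg)
      fix t
      have "(u t)\<^sup>2 + (2 * s) * (u t * v t) + s\<^sup>2 * (v t)\<^sup>2 = (u t + s * v t)\<^sup>2"
        by (simp add: power2_eq_square algebra_simps)
      then show "0 \<le> (u t)\<^sup>2 + (2 * s) * (u t * v t) + s\<^sup>2 * (v t)\<^sup>2"
        by simp
    qed
  qed
  have "0 \<le> C"
    unfolding C_def by (intro integral_nonneg int) simp
  show ?thesis
  proof (cases "C = 0")
    case True
    have "B = 0"
    proof (rule ccontr)
      assume "B \<noteq> 0"
      then show False
        using quad[of "- (A + 1) / (2 * B)"] True by (simp add: field_simps)
    qed
    then show ?thesis
      using True by (simp add: A_def B_def C_def)
  next
    case False
    then have "0 < C"
      using \<open>0 \<le> C\<close> by simp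
    have "A + 2 * (- B / C) * B + (- B / C)\<^sup>2 * C = A - B\<^sup>2 / C"
      using False by (simp add: field_simps power2_eq_square)
    then have "B\<^sup>2 / C \<le> A"
      using quad[of "- B / C"] by linarith
    then have "B\<^sup>2 \<le> A * C"
      using \<open>0 < C\<close> by (simp add: field_simps)
    then show ?thesis
      by (simp add: A_def B_def C_def)
  qed
qed

lemma integral_Minkowski:
  fixes u v :: "real \<Rightarrow> real"
  assumes u: "continuous_on {0..1} u" and v: "continuous_on {0..1} v"
  shows "sqrt (integral {0..1} (\<lambda>t. (u t + v t)\<^sup>2))
    \<le> sqrt (integral {0..1} (\<lambda>t. (u t)\<^sup>2)) + sqrt (integral {0..1} (\<lambda>t. (v t)\<^sup>2))"
proof (rule real_le_lsqrt)
  define A B C where "A = integral {0..1} (\<lambda>t. (u t)\<^sup>2)"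
    and "B = integral {0..1} (\<lambda>t. u t * v t)" and "C = integral {0..1} (\<lambda>t. (v t)\<^sup>2)"
  have int: "(\<lambda>t. (u t)\<^sup>2) integrable_on {0..1}" "(\<lambda>t. u t * v t) integrable_on {0..1}"
    "(\<lambda>t. (v t)\<^sup>2) integrable_on {0..1}"
    by (intro integrable_continuous_interval continuous_intros u v)+
  have "((\<lambda>t. (u t)\<^sup>2 + 2 * (u t * v t) + (v t)\<^sup>2) has_integral (A + 2 * B + C)) {0..1}"
    unfolding A_def B_def C_def
    by (intro has_integral_add has_integral_mult_right integrable_integral int)
  moreover have "(\<lambda>t. (u t)\<^sup>2 + 2 * (u t * v t) + (v t)\<^sup>2) = (\<lambda>t. (u t + v t)\<^sup>2)"
    by (auto simp: power2_eq_square algebra_simps)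
  ultimately have sum: "integral {0..1} (\<lambda>t. (u t + v t)\<^sup>2) = A + 2 * B + C"
    by (simp add: integral_unique)
  have nn: "0 \<le> A" "0 \<le> C"
    unfolding A_def C_def by (intro integral_nonneg int; simp)+
  have "B \<le> sqrt (A * C)"
    using integral_Cauchy_Schwarz[OF u v] unfolding A_def B_def C_def
    by (rule real_le_rsqrt)
  then have "B \<le> sqrt A * sqrt C"
    by (simp add: real_sqrt_mult)
  then show "integral {0..1} (\<lambda>t. (u t + v t)\<^sup>2)
      \<le> (sqrt (integral {0..1} (\<lambda>t. (u t)\<^sup>2)) + sqrt (integral {0..1} (\<lambda>t. (v t)\<^sup>2)))\<^sup>2"
    using nn unfolding sum A_def[symmetric] C_def[symmetric] by (simp add: power2_sum)
  show "0 \<le> sqrt (integral {0..1} (\<lambda>t. (u t)\<^sup>2)) + sqrt (integral {0..1} (\<lambda>t. (v t)\<^sup>2))"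
    using nn unfolding A_def[symmetric] C_def[symmetric] by simp
qed

definition sqrt_C01 :: "C01 \<Rightarrow> real \<Rightarrow> real" where
  "sqrt_C01 f t = sqrt (Re (f (Abs_unit_interval t)))"

lemma continuous_on_sqrt_C01: "continuous_on {0..1} (sqrt_C01 f)"
  unfolding sqrt_C01_def by (intro continuous_intros continuous_on_C01)

lemma bures_dist_rho:
  assumes x: "x \<in> density_space rho" and y: "y \<in> density_space rho"
  shows "bures_dist rho x y
    = sqrt (integral {0..1} (\<lambda>t. (sqrt_C01 x t - sqrt_C01 y t)\<^sup>2)) / sqrt 2"
proof -
  have pos: "x \<in> positive_elements" "y \<in> positive_elements"
    using x y by (auto simp: density_space_def)
  have nn: "0 \<le> Re (x t)" "0 \<le> Re (y t)" for t
    using pos by (auto simp: positive_elements_C01 complex_nonneg_Reals_iff)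
  have one: "integral {0..1} (\<lambda>t. (sqrt_C01 z t)\<^sup>2) = 1" if "z \<in> density_space rho" for z
  proof -
    have z: "z \<in> positive_elements" "rho z = 1"
      using that by (auto simp: density_space_def)
    then have "(sqrt_C01 z t)\<^sup>2 = Re (z (Abs_unit_interval t))" for t
      by (auto simp: sqrt_C01_def positive_elements_C01 complex_nonneg_Reals_iff)
    then show ?thesis
      using z rho_Re[of z] by simp
  qed
  have cont: "continuous_on {0..1} (\<lambda>t. sqrt_C01 x t * sqrt_C01 y t)"
    by (intro continuous_intros continuous_on_sqrt_C01)
  have rho: "rho (cstar_abs (positive_sqrt x * positive_sqrt y))
      = of_real (integral {0..1} (\<lambda>t. sqrt_C01 x t * sqrt_C01 y t))"
    using nn
    by (intro rho_of_real cont)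
      (simp add: cstar_abs_C01 positive_sqrt_C01 pos sqrt_C01_def norm_mult)
  have int: "(\<lambda>t. (sqrt_C01 x t)\<^sup>2) integrable_on {0..1}" "(\<lambda>t. (sqrt_C01 y t)\<^sup>2) integrable_on {0..1}"
    "(\<lambda>t. sqrt_C01 x t * sqrt_C01 y t) integrable_on {0..1}"
    by (intro integrable_continuous_interval continuous_intros continuous_on_sqrt_C01)+
  have "((\<lambda>t. (sqrt_C01 x t)\<^sup>2 + (sqrt_C01 y t)\<^sup>2 - 2 * (sqrt_C01 x t * sqrt_C01 y t)) has_integral
      (1 + 1 - 2 * integral {0..1} (\<lambda>t. sqrt_C01 x t * sqrt_C01 y t))) {0..1}"
    using int one x y
    by (intro has_integral_diff has_integral_add has_integral_mult_right)
      (metis integrable_integral)+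
  moreover have "(\<lambda>t. (sqrt_C01 x t)\<^sup>2 + (sqrt_C01 y t)\<^sup>2 - 2 * (sqrt_C01 x t * sqrt_C01 y t))
      = (\<lambda>t. (sqrt_C01 x t - sqrt_C01 y t)\<^sup>2)"
    by (auto simp: power2_eq_square algebra_simps)
  ultimately have "integral {0..1} (\<lambda>t. (sqrt_C01 x t - sqrt_C01 y t)\<^sup>2)
      = 2 * (1 - integral {0..1} (\<lambda>t. sqrt_C01 x t * sqrt_C01 y t))"
    by (simp add: integral_unique)
  then show ?thesis
    using x y by (simp add: bures_dist_def rho flip: real_sqrt_divide)
qed

lemma Metric_space_bures_dist_rho: "Metric_space (density_space rho) (bures_dist rho)"
proof (rule Metric_space.intro)
  have cont: "continuous_on {0..1} (\<lambda>t. sqrt_C01 x t - sqrt_C01 y t)" for x y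
    by (intro continuous_intros continuous_on_sqrt_C01)
  have cont2: "continuous_on {0..1} (\<lambda>t. (sqrt_C01 x t - sqrt_C01 y t)\<^sup>2)" for x y
    by (intro continuous_intros continuous_on_sqrt_C01)
  fix x y :: C01
  show "0 \<le> bures_dist rho x y"
  proof (cases "x \<in> density_space rho \<and> y \<in> density_space rho")
    case True
    then show ?thesis
      by (simp add: bures_dist_rho integral_nonneg integrable_continuous_interval cont2)
  next
    case False
    then show ?thesis
      by (auto simp: bures_dist_def)
  qed
  show "bures_dist rho x y = bures_dist rho y x"
  proof (cases "x \<in> density_space rho \<and> y \<in> density_space rho")
    case True
    then show ?thesis
      by (simp add: bures_dist_rho power2_commute)
  next
    case False
    then show ?thesis
      by (auto simp: bures_dist_def)
  qed
  assume x: "x \<in> density_space rho" and y: "y \<in> density_space rho"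
  show "bures_dist rho x y = 0 \<longleftrightarrow> x = y"
  proof
    assume "bures_dist rho x y = 0"
    then have "\<forall>t\<in>{0..1}. sqrt_C01 x t = sqrt_C01 y t"
      using x y integral_eq_0_iff[OF cont2] by (simp add: bures_dist_rho)
    then show "x = y"
      using x y
      by (intro C01_eqI)
        (auto simp: sqrt_C01_def density_space_def positive_elements_C01 complex_nonneg_Reals_iff
          complex_eq_iff)
  qed (use x y in \<open>simp add: bures_dist_rho\<close>)
  fix z
  assume z: "z \<in> density_space rho"
  show "bures_dist rho x z \<le> bures_dist rho x y + bures_dist rho y z"
    using integral_Minkowski[OF cont[of x y] cont[of y z]] x y z
    by (simp add: bures_dist_rho divide_right_mono flip: add_divide_distrib)
qed

end

theory Submission
  imports Defs
begin

text \<open>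
  Both halves rest on the commutative Powers--Stormer inequality
  \<open>2 (bures_dist rho x y)\<^sup>2 \<le> \<integral> \<bar>x - y\<bar>\<close> (lemma \<open>bures_dist_rho_le_L1\<close>), which follows by integrating
  \<open>(\<surd>a - \<surd>b)\<^sup>2 \<le> \<bar>a - b\<bar>\<close>.  The integral is at most the supremum norm of \<open>x - y\<close>, so small norm
  balls lie inside Bures balls and the norm topology is finer.

  It is strictly finer because an integral barely sees a thin peak.  For \<open>n \<ge> 1\<close> the densities
  \<open>1 - 1 / (n + 1) + t ^ n\<close> have a peak at \<open>t = 1\<close> of height at least \<open>3 / 2\<close>, so they keep
  norm distance at least \<open>1 / 2\<close> from the constant density \<open>1\<close>, whereas their \<open>L\<^sup>1\<close> distance to it
  is at most \<open>2 / (n + 1)\<close>.  They therefore come into every Bures ball around \<open>1\<close> but never the norm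
  ball of radius \<open>1 / 2\<close>, and that ball is open for the norm only.
\<close>

text \<open>The factor \<open>\<surd>a + \<surd>b\<close> of \<open>a - b\<close> dominates the factor \<open>\<surd>a - \<surd>b\<close> in absolute value.\<close>

lemma sqrt_diff_power2_le:
  fixes a b :: real
  assumes "0 \<le> a" "0 \<le> b"
  shows "(sqrt a - sqrt b)\<^sup>2 \<le> \<bar>a - b\<bar>"
proof -
  have "\<bar>sqrt a - sqrt b\<bar> * \<bar>sqrt a - sqrt b\<bar> \<le> \<bar>sqrt a - sqrt b\<bar> * (sqrt a + sqrt b)"
    using assms real_sqrt_ge_zero[of a] real_sqrt_ge_zero[of b]
    by (intro mult_left_mono) (auto simp: abs_if)
  also have "\<dots> = \<bar>(sqrt a - sqrt b) * (sqrt a + sqrt b)\<bar>"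
    using assms by (simp add: abs_mult)
  also have "(sqrt a - sqrt b) * (sqrt a + sqrt b) = a - b"
    using assms by (simp add: algebra_simps)
  finally show ?thesis
    by (simp add: power2_eq_square flip: abs_mult)
qed

text \<open>
  The bound is stated for any integral that dominates \<open>\<integral> \<bar>x - y\<bar>\<close>: a constant function will give
  the comparison with the norm, an explicit polynomial the estimate for the peaks.
\<close>

lemma bures_dist_rho_le_L1:
  assumes x: "x \<in> density_space rho" and y: "y \<in> density_space rho"
    and g: "(g has_integral I) {0..1}"
    and bound: "\<And>t. t \<in> {0..1} \<Longrightarrow>
      \<bar>Re (x (Abs_unit_interval t)) - Re (y (Abs_unit_interval t))\<bar> \<le> g t"
  shows "bures_dist rho x y \<le> sqrt (I / 2)"
proof -
  have nn: "0 \<le> Re (x t)" "0 \<le> Re (y t)" for t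
    using x y by (auto simp: density_space_def positive_elements_C01 complex_nonneg_Reals_iff)
  have "integral {0..1} (\<lambda>t. (sqrt_C01 x t - sqrt_C01 y t)\<^sup>2) \<le> integral {0..1} g"
  proof (rule integral_le)
    show "(\<lambda>t. (sqrt_C01 x t - sqrt_C01 y t)\<^sup>2) integrable_on {0..1}"
      by (intro integrable_continuous_interval continuous_intros continuous_on_sqrt_C01)
    show "g integrable_on {0..1}"
      using g by blast
    show "(sqrt_C01 x t - sqrt_C01 y t)\<^sup>2 \<le> g t" if "t \<in> {0..1}" for t
      unfolding sqrt_C01_def using sqrt_diff_power2_le[OF nn] bound[OF that] by (rule order_trans)
  qed
  then show ?thesis
    using g by (simp add: bures_dist_rho[OF x y] integral_unique flip: real_sqrt_divide)
qed

lemma bures_dist_rho_le_norm: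
  assumes x: "x \<in> density_space rho" and y: "y \<in> density_space rho"
  shows "bures_dist rho x y \<le> sqrt (cstar_norm_dist x y / 2)"
proof (rule bures_dist_rho_le_L1[OF x y])
  show "((\<lambda>_::real. cstar_norm_dist x y) has_integral cstar_norm_dist x y) {0..1}"
    using has_integral_const_real[of "cstar_norm_dist x y" 0 1] by simp
  show "\<bar>Re (x s) - Re (y s)\<bar> \<le> cstar_norm_dist x y" for s
    using abs_Re_le_cmod[of "x s - y s"] norm_bounded[of "x - y" s]
    by (simp add: cstar_norm_dist_def)
qed

text \<open>The constant part makes up for the mass \<open>1 / (n + 1)\<close> of the power, so the integral is \<open>1\<close>.\<close>

definition peak :: "nat \<Rightarrow> C01" where
  "peak n = Bcontfun (\<lambda>s. complex_of_real (1 - 1 / (real n + 1) + Rep_unit_interval s ^ n))"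

lemma peak_apply: "apply_bcontfun (peak n) s = of_real (1 - 1 / (real n + 1) + Rep_unit_interval s ^ n)"
proof -
  have "continuous_on UNIV Rep_unit_interval"
    by (auto simp: continuous_on_iff dist_unit_interval_def)
  then have "(\<lambda>s. complex_of_real (1 - 1 / (real n + 1) + Rep_unit_interval s ^ n)) \<in> bcontfun"
    unfolding bcontfun_unit_interval by (intro continuous_intros)
  then show ?thesis
    by (simp add: peak_def Bcontfun_inverse)
qed

lemma has_integral_power_unit: "((\<lambda>t::real. t ^ n) has_integral 1 / (real n + 1)) {0..1}"
proof -
  have "((\<lambda>t::real. t ^ (n + 1) / (real n + 1)) has_vector_derivative t ^ n)
      (at t within {0..1})" for t
    unfolding has_real_derivative_iff_has_vector_derivative[symmetric]
    by (rule derivative_eq_intros refl | simp add: add_nonneg_eq_0_iff add.commute)+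
  from fundamental_theorem_of_calculus[OF zero_le_one this] show ?thesis
    by simp
qed

lemma peak_in_density_space: "peak n \<in> density_space rho"
proof -
  have "((\<lambda>t::real. 1 - 1 / (real n + 1) + t ^ n) has_integral
      (1 - 1 / (real n + 1)) + 1 / (real n + 1)) {0..1}"
    using has_integral_const_real[of "1 - 1 / (real n + 1)" 0 1]
    by (intro has_integral_add has_integral_power_unit) simp
  then have "integral {0..1} (\<lambda>t::real. 1 - 1 / (real n + 1) + t ^ n) = 1"
    by (simp add: integral_unique)
  moreover have "rho (peak n) = of_real (integral {0..1} (\<lambda>t::real. 1 - 1 / (real n + 1) + t ^ n))"
    by (intro rho_of_real continuous_intros) (simp add: peak_apply Abs_unit_interval_inverse)
  moreover have "peak n \<in> positive_elements"
    unfolding positive_elements_C01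
  proof
    show "apply_bcontfun (peak n) s \<in> \<real>\<^sub>\<ge>\<^sub>0" for s
      using Rep_unit_interval[of s] unfolding peak_apply nonneg_Reals_of_real_iff
      by (intro add_nonneg_nonneg) auto
  qed
  ultimately show ?thesis
    by (simp add: density_space_def)
qed

lemma one_in_density_space: "1 \<in> density_space rho"
  using rho_of_real[of 1 "\<lambda>_. 1"] by (simp add: density_space_def positive_elements_C01)

lemma bures_dist_one_peak: "bures_dist rho 1 (peak n) \<le> sqrt (1 / (real n + 1))"
proof -
  have "((\<lambda>t::real. 1 / (real n + 1) + t ^ n) has_integral 1 / (real n + 1) + 1 / (real n + 1)) {0..1}"
    using has_integral_const_real[of "1 / (real n + 1)" 0 1]
    by (intro has_integral_add has_integral_power_unit) simp
  then have "bures_dist rho 1 (peak n) \<le> sqrt ((1 / (real n + 1) + 1 / (real n + 1)) / 2)"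
  proof (rule bures_dist_rho_le_L1[OF one_in_density_space peak_in_density_space])
    fix t :: real
    assume t: "t \<in> {0..1}"
    then have "0 \<le> t ^ n"
      by simp
    then have "\<bar>1 / (real n + 1) - t ^ n\<bar> \<le> 1 / (real n + 1) + t ^ n"
      by (simp add: abs_le_iff)
    then show "\<bar>Re (apply_bcontfun 1 (Abs_unit_interval t)) - Re (peak n (Abs_unit_interval t))\<bar>
        \<le> 1 / (real n + 1) + t ^ n"
      using t by (simp add: peak_apply Abs_unit_interval_inverse)
  qed
  then show ?thesis
    by (simp only: field_sum_of_halves add_divide_distrib)
qed

lemma cstar_norm_dist_one_peak:
  assumes "1 \<le> n"
  shows "1 / 2 \<le> cstar_norm_dist 1 (peak n)"
proof -
  have "apply_bcontfun (1 - peak n) (Abs_unit_interval 1) = complex_of_real (1 / (real n + 1) - 1)"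
    by (simp add: peak_apply Abs_unit_interval_inverse)
  then have "cmod (apply_bcontfun (1 - peak n) (Abs_unit_interval 1)) = \<bar>1 / (real n + 1) - 1\<bar>"
    by (simp only: norm_of_real)
  then have "\<bar>1 / (real n + 1) - 1\<bar> \<le> cstar_norm_dist 1 (peak n)"
    unfolding cstar_norm_dist_def by (metis norm_bounded)
  moreover have "1 / (real n + 1) \<le> 1 / 2"
    using assms by (simp add: field_simps)
  ultimately show ?thesis
    by linarith
qed

theorem proposition2p5:
  shows "{U. openin (Metric_space.mtopology (density_space rho) (bures_dist rho)) U}
       \<subset> {U. openin (Metric_space.mtopology (density_space rho) cstar_norm_dist) U}"
proof -
  interpret B: Metric_space "density_space rho" "bures_dist rho"
    by (rule Metric_space_bures_dist_rho)
  interpret N: Metric_space "density_space rho" cstar_norm_dist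
    by (rule Metric_space_cstar_norm_dist)
  show ?thesis
  proof (rule psubsetI)
    show "{U. openin B.mtopology U} \<subseteq> {U. openin N.mtopology U}"
    proof clarify
      fix U
      assume U: "openin B.mtopology U"
      have "\<exists>r>0. N.mball x r \<subseteq> U" if x: "x \<in> U" for x
      proof -
        obtain r where r: "0 < r" "B.mball x r \<subseteq> U"
          using U x unfolding B.openin_mtopology by blast
        (* the radius s for which the comparison bound sqrt (s / 2) equals r *)
        have "N.mball x (2 * r\<^sup>2) \<subseteq> B.mball x r"
        proof
          fix y
          assume "y \<in> N.mball x (2 * r\<^sup>2)"
          then have xy: "x \<in> density_space rho" "y \<in> density_space rho"
            and d: "cstar_norm_dist x y / 2 < r\<^sup>2"
            by auto
          have "bures_dist rho x y \<le> sqrt (cstar_norm_dist x y / 2)"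
            by (rule bures_dist_rho_le_norm[OF xy])
          also have "\<dots> < r"
            using d r(1) by (intro real_less_lsqrt) auto
          finally show "y \<in> B.mball x r"
            using xy by simp
        qed
        then show ?thesis
          using r by (intro exI[of _ "2 * r\<^sup>2"]) auto
      qed
      then show "openin N.mtopology U"
        using U unfolding B.openin_mtopology N.openin_mtopology by blast
    qed
    have "\<not> openin B.mtopology (N.mball 1 (1 / 2))"
    proof
      assume "openin B.mtopology (N.mball 1 (1 / 2))"
      moreover have "1 \<in> N.mball 1 (1 / 2)"
        using one_in_density_space by simp
      ultimately obtain r where r: "0 < r" "B.mball 1 r \<subseteq> N.mball 1 (1 / 2)"
        unfolding B.openin_mtopology by blast
      obtain n :: nat where n: "1 / r\<^sup>2 < n"
        using reals_Archimedean2 by blast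
      moreover have "0 < 1 / r\<^sup>2"
        using r(1) by simp
      ultimately have pos: "0 < real n"
        by linarith
      have "1 / (real n + 1) < 1 / real n"
        using pos by (simp add: field_simps)
      also have "\<dots> < r\<^sup>2"
        using n r(1) pos by (simp add: field_simps)
      finally have "1 / (real n + 1) < r\<^sup>2" .
      then have "sqrt (1 / (real n + 1)) < r"
        using r(1) by (intro real_less_lsqrt) auto
      then have "peak n \<in> B.mball 1 r"
        using bures_dist_one_peak[of n] one_in_density_space peak_in_density_space by simp
      then have "cstar_norm_dist 1 (peak n) < 1 / 2"
        using r(2) by auto
      then show False
        using cstar_norm_dist_one_peak[of n] pos by simp
    qed
    then show "{U. openin B.mtopology U} \<noteq> {U. openin N.mtopology U}"
      using N.openin_mball by blast
  qed
qed

end
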